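(* Let $A\in\mathbb{R}^{m\times n}$ ($m\le n$) have full row rank $m$, let $b\in\mathbb{R}^m$, $c\in\mathbb{R}^n$, let $(x^*,y^*,s^* )$ be a solution of (PD), and let $\hat\mu>0$ and $\xi\in(0,1)$. Then there exist vectors $\hat\lambda_L=\hat\lambda_L(x^*,s^*,\hat\mu,\xi)>0$ and $\hat\lambda_U=\hat\lambda_U(x^*,s^*,\hat\mu,\xi)>0$ in $\mathbb{R}^n$ such that for all $\lambda$ with $\hat\lambda_L\le\lambda\le\hat\lambda_U$, the point $(x^*,y^*,s^* )$ is strictly feasible for (PD$_\lambda$) and satisfies $$\xi\hat\mu\, e\le (X^*+\Lambda)(S^*+\Lambda)e\le \frac1\xi\hat\mu\, e.$$
   Context: Vector inequalities are componentwise; $e$ is the vector of ones; $X^*=\mathrm{diag}(x^* )$, $S^*=\mathrm{diag}(s^* )$, $\Lambda=\mathrm{diag}(\lambda)$. (PD) is the primal-dual pair of linear programs: minimize $c^Tx$ subject to $Ax=b$, $x\ge 0$; and maximize $b^Ty$ subject to $A^Ty+s=c$, $s\ge0$. A solution of (PD) is a triple $(x^*,y^*,s^* )\in\mathbb{R}^n\times\mathbb{R}^m\times\mathbb{R}^n$ with $x^*$ primal optimal and $(y^*,s^* )$ dual optimal. For $\lambda\ge0$, (PD$_\lambda$) is the perturbed pair: minimize $(c+\lambda)^T(x+\lambda)$ subject to $Ax=b$, $x\ge-\lambda$; and maximize $(b+A\lambda)^Ty$ subject to $A^Ty+s=c$, $s\ge-\lambda$. A point $(x,y,s)$ is strictly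 feasible for (PD$_\lambda$) if $Ax=b$, $A^Ty+s=c$, $x+\lambda>0$ and $s+\lambda>0$. *)

theory Defs
  imports "HOL-Analysis.Analysis"
begin

(* The library order \<le> on real^'n is componentwise, but the library's strict order
   u < v is u \<le> v together with not v \<le> u, which is strictly weaker than the
   componentwise strict inequality. *)
definition vec_less :: "real^'n \<Rightarrow> real^'n \<Rightarrow> bool"  (infix "\<prec>\<^sub>v" 50) where
  "u \<prec>\<^sub>v v \<longleftrightarrow> (\<forall>i. u $ i < v $ i)"

definition diag :: "real^'n \<Rightarrow> real^'n^'n" where
  "diag v = (\<chi> i j. if i = j then v $ i else 0)"

definition primal_feasible :: "real^'n^'m \<Rightarrow> real^'m \<Rightarrow> real^'n \<Rightarrow> bool" where
  "primal_feasible A b x \<longleftrightarrow> A *v x = b \<and> 0 \<le> x"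

definition dual_feasible :: "real^'n^'m \<Rightarrow> real^'n \<Rightarrow> real^'m \<Rightarrow> real^'n \<Rightarrow> bool" where
  "dual_feasible A c y s \<longleftrightarrow> transpose A *v y + s = c \<and> 0 \<le> s"

definition primal_optimal :: "real^'n^'m \<Rightarrow> real^'m \<Rightarrow> real^'n \<Rightarrow> real^'n \<Rightarrow> bool" where
  "primal_optimal A b c x \<longleftrightarrow>
     primal_feasible A b x \<and> (\<forall>x'. primal_feasible A b x' \<longrightarrow> c \<bullet> x \<le> c \<bullet> x')"

definition dual_optimal ::
  "real^'n^'m \<Rightarrow> real^'m \<Rightarrow> real^'n \<Rightarrow> real^'m \<Rightarrow> real^'n \<Rightarrow> bool" where
  "dual_optimal A b c y s \<longleftrightarrow>
     dual_feasible A c y s \<and> (\<forall>y' s'. dual_feasible A c y' s' \<longrightarrow> b \<bullet> y' \<le> b \<bullet> y)"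

definition PD_solution ::
  "real^'n^'m \<Rightarrow> real^'m \<Rightarrow> real^'n \<Rightarrow> real^'n \<Rightarrow> real^'m \<Rightarrow> real^'n \<Rightarrow> bool" where
  "PD_solution A b c x y s \<longleftrightarrow> primal_optimal A b c x \<and> dual_optimal A b c y s"

(* Strict feasibility for the perturbed pair
     min (c + l)^T (x + l)   subject to  A x = b,          x \<ge> -l,
     max (b + A l)^T y       subject to  A^T y + s = c,    s \<ge> -l,
   where l \<ge> 0; the perturbed objectives play no role in it. *)
definition perturbed_strictly_feasible ::
  "real^'n^'m \<Rightarrow> real^'m \<Rightarrow> real^'n \<Rightarrow> real^'n \<Rightarrow> real^'n \<Rightarrow> real^'m \<Rightarrow> real^'n \<Rightarrow> bool" where
  "perturbed_strictly_feasible A b c l x y s \<longleftrightarrow>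
     A *v x = b \<and> transpose A *v y + s = c \<and> 0 \<prec>\<^sub>v x + l \<and> 0 \<prec>\<^sub>v s + l"

end

theory Submission
  imports Defs
begin

text \<open>
  At a primal-dual solution the products \<open>x\<^sub>i s\<^sub>i\<close> vanish: this is complementary slackness.  Hence
  \<open>(x\<^sub>i + t) (s\<^sub>i + t) = t (t + (x\<^sub>i + s\<^sub>i))\<close> for every shift \<open>t\<close>, a function of \<open>t \<ge> 0\<close> that grows
  strictly from \<open>0\<close> to infinity.  Let \<open>lambda_L\<close> and \<open>lambda_U\<close> collect, coordinate by coordinate,
  the shifts at which it takes the values \<open>\<xi> \<mu>\<close> and \<open>\<mu> / \<xi>\<close>.  They are positive because both values
  are, strictly ordered because \<open>\<xi> \<mu> < \<mu> / \<xi>\<close>, and by monotonicity every \<open>l\<close> between them keeps the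
  products within the two bounds.

  Optimality is given separately for the primal and for the dual, so complementary slackness needs
  strong duality.  If the primal optimal value exceeded the dual one, the point formed by \<open>b\<close> and the
  dual value would lie outside the closed cone of all pairs \<open>(A x, c \<bullet> x)\<close> with \<open>x \<ge> 0\<close>.  A
  hyperplane separating it from that cone can be rescaled to a dual feasible point with a value above
  the dual optimum, which is absurd (lemmas \<open>farkas_convex_cone_hull\<close> and \<open>PD_solution_no_duality_gap\<close>).
\<close>

section \<open>Complementary slackness of primal-dual solutions\<close>

text \<open>
  A finitely generated cone is closed, so the point can be separated from it strictly.  The separating
  functional is then nonnegative on the cone, since a negative value could be scaled to any other
  negative value.
\<close>

lemma farkas_convex_cone_hull:
  fixes G :: "'a::euclidean_space set"
  assumes "finite G" and "z \<notin> convex_cone hull G"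
  obtains a where "a \<bullet> z < 0" and "\<And>g. g \<in> G \<Longrightarrow> 0 \<le> a \<bullet> g"
proof -
  obtain a \<beta> where z: "a \<bullet> z < \<beta>" and K: "\<And>x. x \<in> convex_cone hull G \<Longrightarrow> \<beta> < a \<bullet> x"
    using separating_hyperplane_closed_point[OF convex_convex_cone_hull
        closed_convex_cone_hull[OF assms(1)] assms(2)] by blast
  have neg: "\<beta> < 0"
    using K[OF convex_cone_hull_contains_0] by simp
  have "0 \<le> a \<bullet> g" if "g \<in> G" for g
  proof (rule ccontr)
    assume "\<not> 0 \<le> a \<bullet> g"
    then have ag: "a \<bullet> g < 0" by simp
    have "(\<beta> / (a \<bullet> g)) *\<^sub>R g \<in> convex_cone hull G"
      using ag neg that by (intro convex_cone_hull_mul) (auto simp: hull_inc divide_nonpos_nonpos)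
    from K[OF this] show False
      using ag by simp
  qed
  moreover have "a \<bullet> z < 0"
    using z neg by simp
  ultimately show thesis
    using that by blast
qed

text \<open>
  Pairing each column of \<open>A\<close> with its cost turns "right-hand side \<open>b\<close> is attainable at cost \<open>\<gamma>\<close>" into
  membership of \<open>(b, \<gamma>)\<close> in a finitely generated cone, to which Farkas' lemma applies; the coefficients
  of a point of the cone are the coordinates of \<open>x\<close>.
\<close>

lemma cost_cone_member:
  fixes A :: "real^'n^'m" and c :: "real^'n"
  assumes "p \<in> convex_cone hull (range (\<lambda>i. (A *v axis i 1, c $ i)))"
  obtains x where "0 \<le> x" and "A *v x = fst p" and "c \<bullet> x = snd p"
proof -
  let ?K = "{q. \<exists>x. 0 \<le> x \<and> A *v x = fst q \<and> c \<bullet> x = snd q}"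
  have "convex_cone hull (range (\<lambda>i. (A *v axis i 1, c $ i))) \<subseteq> ?K"
  proof (rule hull_minimal)
    have "(A *v axis i 1, c $ i) \<in> ?K" for i
    proof -
      have "0 \<le> (axis i 1 :: real^'n)"
        by (simp add: less_eq_vec_def axis_def)
      then show ?thesis
        by (auto intro!: exI[of _ "axis i 1"] simp: inner_axis)
    qed
    then show "range (\<lambda>i. (A *v axis i 1, c $ i)) \<subseteq> ?K"
      by blast
    have "q + r \<in> ?K" if "q \<in> ?K" "r \<in> ?K" for q r
    proof -
      from that(1) obtain u where u: "0 \<le> u" "A *v u = fst q" "c \<bullet> u = snd q"
        by auto
      from that(2) obtain v where v: "0 \<le> v" "A *v v = fst r" "c \<bullet> v = snd r"
        by auto
      from u v have "0 \<le> u + v" "A *v (u + v) = fst (q + r)" "c \<bullet> (u + v) = snd (q + r)"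
        by (simp_all add: matrix_vector_right_distrib inner_add_right)
      then show ?thesis
        by blast
    qed
    moreover have "t *\<^sub>R q \<in> ?K" if "q \<in> ?K" "0 \<le> t" for q t
    proof -
      from that(1) obtain u where "0 \<le> u" "A *v u = fst q" "c \<bullet> u = snd q"
        by auto
      with that(2) have "0 \<le> t *\<^sub>R u" "A *v (t *\<^sub>R u) = fst (t *\<^sub>R q)"
        "c \<bullet> (t *\<^sub>R u) = snd (t *\<^sub>R q)"
        by (simp_all add: matrix_vector_mult_scaleR scaleR_nonneg_nonneg)
      then show ?thesis
        by blast
    qed
    moreover have "0 \<in> ?K"
      by (auto intro!: exI[of _ 0])
    ultimately show "convex_cone ?K"
      unfolding convex_cone_iff by blast
  qed
  with assms that show thesis
    by blast
qed

lemma inner_nonneg_cart: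
  fixes u v :: "real^'n"
  assumes "0 \<le> u" and "0 \<le> v"
  shows "0 \<le> u \<bullet> v"
  using assms by (auto simp: inner_vec_def less_eq_vec_def intro!: sum_nonneg)

lemma duality_gap_eq:
  assumes "primal_feasible A b x" and "dual_feasible A c y s"
  shows "c \<bullet> x = b \<bullet> y + x \<bullet> s"
proof -
  have c: "c = y v* A + s" and b: "b = A *v x"
    using assms by (auto simp: primal_feasible_def dual_feasible_def)
  show ?thesis
    unfolding b c by (simp add: inner_add_left dot_lmul_matrix
        inner_commute[of "A *v x" y] inner_commute[of s x])
qed

text \<open>
  In the separating functional \<open>(u, \<tau>)\<close> the cost component \<open>\<tau>\<close> is positive, because the functional
  takes a nonnegative value at the primal solution and a negative one at the point with the same
  right-hand side and lower cost.  Therefore \<open>- u / \<tau>\<close> is a dual point, and it beats \<open>y\<close>.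
\<close>

lemma PD_solution_no_duality_gap:
  fixes A :: "real^'n^'m"
  assumes "PD_solution A b c x y s"
  shows "c \<bullet> x = b \<bullet> y"
proof (rule ccontr)
  assume gap: "c \<bullet> x \<noteq> b \<bullet> y"
  have pf: "primal_feasible A b x" and df: "dual_feasible A c y s"
    and popt: "\<And>x'. primal_feasible A b x' \<Longrightarrow> c \<bullet> x \<le> c \<bullet> x'"
    and dopt: "\<And>y' s'. dual_feasible A c y' s' \<Longrightarrow> b \<bullet> y' \<le> b \<bullet> y"
    using assms by (auto simp: PD_solution_def primal_optimal_def dual_optimal_def)
  have x: "A *v x = b" "0 \<le> x"
    using pf by (auto simp: primal_feasible_def)
  have lt: "b \<bullet> y < c \<bullet> x"
    using duality_gap_eq[OF pf df] inner_nonneg_cart[of x s] pf df gap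
    by (auto simp: primal_feasible_def dual_feasible_def)
  let ?G = "range (\<lambda>i. (A *v axis i 1, c $ i))"
  have "(b, b \<bullet> y) \<notin> convex_cone hull ?G"
  proof
    assume "(b, b \<bullet> y) \<in> convex_cone hull ?G"
    then obtain x' where "0 \<le> x'" "A *v x' = b" "c \<bullet> x' = b \<bullet> y"
      by (rule cost_cone_member) simp
    with popt[of x'] lt show False
      by (simp add: primal_feasible_def)
  qed
  then obtain a where a: "a \<bullet> (b, b \<bullet> y) < 0" and G: "\<And>g. g \<in> ?G \<Longrightarrow> 0 \<le> a \<bullet> g"
    using farkas_convex_cone_hull[of ?G "(b, b \<bullet> y)"] by auto
  obtain u \<tau> where a_eq: "a = (u, \<tau>)"
    by (cases a)
  have sep: "u \<bullet> b + \<tau> * (b \<bullet> y) < 0"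
    using a by (simp add: a_eq)
  have cols: "0 \<le> u v* A + \<tau> *\<^sub>R c"
  proof (simp add: less_eq_vec_def, intro allI)
    fix i
    have "0 \<le> a \<bullet> (A *v axis i 1, c $ i)"
      by (rule G) blast
    then show "0 \<le> (u v* A) $ i + \<tau> * c $ i"
      by (simp add: a_eq flip: dot_lmul_matrix) (simp add: inner_axis)
  qed
  have "0 \<le> (u v* A + \<tau> *\<^sub>R c) \<bullet> x"
    by (rule inner_nonneg_cart[OF cols x(2)])
  then have "0 \<le> u \<bullet> b + \<tau> * (c \<bullet> x)"
    by (simp add: inner_add_left dot_lmul_matrix x(1))
  with sep have "0 < \<tau> * (c \<bullet> x - b \<bullet> y)"
    by (simp add: right_diff_distrib)
  with lt have \<tau>: "0 < \<tau>"
    by (simp add: zero_less_mult_iff)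
  define y' where "y' = - (1 / \<tau>) *\<^sub>R u"
  have "y' v* A = - (1 / \<tau>) *\<^sub>R (u v* A)"
    by (simp only: y'_def scaleR_vector_matrix_assoc)
  then have slack: "c - y' v* A = (1 / \<tau>) *\<^sub>R (u v* A + \<tau> *\<^sub>R c)"
    using \<tau> by (simp add: scaleR_right_distrib)
  have "0 \<le> c - y' v* A"
    unfolding slack using cols \<tau> by (intro scaleR_nonneg_nonneg) auto
  then have "dual_feasible A c y' (c - y' v* A)"
    by (simp add: dual_feasible_def)
  then have "b \<bullet> y' \<le> b \<bullet> y"
    by (rule dopt)
  moreover have "b \<bullet> y < - (u \<bullet> b) / \<tau>"
    using sep pos_less_divide_eq[OF \<tau>, of "b \<bullet> y" "- (u \<bullet> b)"] by (simp add: mult.commute)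
  then have "b \<bullet> y < b \<bullet> y'"
    by (simp add: y'_def inner_commute[of b u])
  ultimately show False
    by simp
qed

text \<open>
  The gap \<open>c \<bullet> x - b \<bullet> y = x \<bullet> s\<close> is zero, and a sum of nonnegative products vanishes only termwise.
\<close>

lemma PD_solution_complementary:
  assumes "PD_solution A b c x y s"
  shows "x $ i * s $ i = 0"
proof -
  have pf: "primal_feasible A b x" and df: "dual_feasible A c y s"
    using assms by (auto simp: PD_solution_def primal_optimal_def dual_optimal_def)
  have "(\<Sum>j\<in>UNIV. x $ j * s $ j) = 0"
    using duality_gap_eq[OF pf df] PD_solution_no_duality_gap[OF assms] by (simp add: inner_vec_def)
  moreover have "0 \<le> x $ j * s $ j" for j
    using pf df by (simp add: primal_feasible_def dual_feasible_def less_eq_vec_def)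
  ultimately show ?thesis
    by (simp add: sum_nonneg_eq_0_iff)
qed

section \<open>The shift that attains a given product\<close>

text \<open>The larger root \<open>t\<close> of \<open>t\<^sup>2 + p t = v\<close>.\<close>

definition shift_root :: "real \<Rightarrow> real \<Rightarrow> real" where
  "shift_root p v = (sqrt (p\<^sup>2 + 4 * v) - p) / 2"

lemma shift_root_eq:
  assumes "0 \<le> v"
  shows "shift_root p v * (shift_root p v + p) = v"
proof -
  have "shift_root p v * (shift_root p v + p) = ((sqrt (p\<^sup>2 + 4 * v))\<^sup>2 - p\<^sup>2) / 4"
    by (simp add: shift_root_def field_simps power2_eq_square)
  also have "\<dots> = v"
    using assms by simp
  finally show ?thesis .
qed

lemma shift_root_strict_mono: "v < w \<Longrightarrow> shift_root p v < shift_root p w"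
  by (simp add: shift_root_def)

lemma shift_root_pos:
  assumes "0 \<le> p" and "0 < v"
  shows "0 < shift_root p v"
  using shift_root_strict_mono[OF assms(2), of p] assms(1) by (simp add: shift_root_def)

lemma shifted_product_bounds:
  assumes "0 \<le> a" "0 \<le> d" "a * d = 0" "0 < v" "0 < w"
    and t: "shift_root (a + d) v \<le> t" "t \<le> shift_root (a + d) w"
  shows "v \<le> (a + t) * (d + t)" and "(a + t) * (d + t) \<le> w"
proof -
  have pos: "0 < shift_root (a + d) v"
    using assms by (intro shift_root_pos) auto
  have eq: "(a + t) * (d + t) = t * (t + (a + d))"
    using assms(3) by (simp add: algebra_simps)
  have "shift_root (a + d) v * (shift_root (a + d) v + (a + d)) \<le> t * (t + (a + d))"
    using pos t assms(1,2) by (intro mult_mono) auto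
  then show "v \<le> (a + t) * (d + t)"
    using assms(4) by (simp add: eq shift_root_eq)
  have "t * (t + (a + d)) \<le> shift_root (a + d) w * (shift_root (a + d) w + (a + d))"
    using pos t assms(1,2) by (intro mult_mono) auto
  then show "(a + t) * (d + t) \<le> w"
    using assms(5) by (simp add: eq shift_root_eq)
qed

section \<open>Perturbations that make a solution well centred\<close>

lemma diag_add: "diag u + diag v = diag (u + v)"
  by (simp add: diag_def vec_eq_iff)

lemma diag_mult_vec_nth: "(diag u *v w) $ i = u $ i * w $ i"
  by (simp add: diag_def matrix_vector_mult_def if_distrib[of "\<lambda>a. a * _"] cong: if_cong)

theorem theorem2:
  assumes "CARD('m::finite) \<le> CARD('n::finite)"
  shows "\<exists>lambda_L lambda_U :: real^'n \<Rightarrow> real^'n \<Rightarrow> real \<Rightarrow> real \<Rightarrow> real^'n.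
    \<forall>(A :: real^'n^'m) (b :: real^'m) (c :: real^'n)
      (x :: real^'n) (y :: real^'m) (s :: real^'n) (\<mu> :: real) (\<xi> :: real).
      rank A = CARD('m) \<and> PD_solution A b c x y s \<and> 0 < \<mu> \<and> 0 < \<xi> \<and> \<xi> < 1 \<longrightarrow>
        0 \<prec>\<^sub>v lambda_L x s \<mu> \<xi> \<and> 0 \<prec>\<^sub>v lambda_U x s \<mu> \<xi> \<and>
        lambda_L x s \<mu> \<xi> \<prec>\<^sub>v lambda_U x s \<mu> \<xi> \<and>
        (\<forall>l :: real^'n. lambda_L x s \<mu> \<xi> \<le> l \<and> l \<le> lambda_U x s \<mu> \<xi> \<longrightarrow>
           perturbed_strictly_feasible A b c l x y s \<and>
           (\<xi> * \<mu>) *\<^sub>R 1 \<le> ((diag x + diag l) ** (diag s + diag l)) *v 1 \<and>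
           ((diag x + diag l) ** (diag s + diag l)) *v 1 \<le> ((1 / \<xi>) * \<mu>) *\<^sub>R 1)"
proof -
  define L U :: "real^'n \<Rightarrow> real^'n \<Rightarrow> real \<Rightarrow> real \<Rightarrow> real^'n"
    where "L = (\<lambda>x s \<mu> \<xi>. \<chi> i. shift_root (x $ i + s $ i) (\<xi> * \<mu>))"
      and "U = (\<lambda>x s \<mu> \<xi>. \<chi> i. shift_root (x $ i + s $ i) (1 / \<xi> * \<mu>))"
  show ?thesis
  proof (rule exI[of _ L], rule exI[of _ U], intro allI impI, elim conjE)
    fix A :: "real^'n^'m" and b c x y s and \<mu> \<xi> :: real
    assume sol: "PD_solution A b c x y s" and \<mu>: "0 < \<mu>" and \<xi>: "0 < \<xi>" "\<xi> < 1"
    have feas: "A *v x = b" "transpose A *v y + s = c" and "0 \<le> x" "0 \<le> s"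
      using sol by (auto simp: PD_solution_def primal_optimal_def dual_optimal_def
          primal_feasible_def dual_feasible_def)
    then have nonneg: "0 \<le> x $ i" "0 \<le> s $ i" for i
      by (auto simp: less_eq_vec_def)
    have pos: "0 < \<xi> * \<mu>" "0 < 1 / \<xi> * \<mu>"
      using \<mu> \<xi> by auto
    have "\<xi> < 1 / \<xi>"
      using \<xi> less_divide_eq_1_pos[of \<xi> 1] by linarith
    then have ordered: "\<xi> * \<mu> < 1 / \<xi> * \<mu>"
      using \<mu> by (rule mult_strict_right_mono)
    have L_pos: "0 < L x s \<mu> \<xi> $ i" for i
      using pos nonneg[of i] by (simp add: L_def shift_root_pos)
    have L_less_U: "L x s \<mu> \<xi> $ i < U x s \<mu> \<xi> $ i" for i
      using shift_root_strict_mono[OF ordered] by (simp add: L_def U_def)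
    have within: "perturbed_strictly_feasible A b c l x y s \<and>
        (\<xi> * \<mu>) *\<^sub>R 1 \<le> ((diag x + diag l) ** (diag s + diag l)) *v 1 \<and>
        ((diag x + diag l) ** (diag s + diag l)) *v 1 \<le> ((1 / \<xi>) * \<mu>) *\<^sub>R 1"
      if "L x s \<mu> \<xi> \<le> l" "l \<le> U x s \<mu> \<xi>" for l
    proof -
      have l: "L x s \<mu> \<xi> $ i \<le> l $ i" "l $ i \<le> U x s \<mu> \<xi> $ i" for i
        using that by (auto simp: less_eq_vec_def)
      have l_pos: "0 < l $ i" for i
        using L_pos[of i] l(1)[of i] by linarith
      have strict: "perturbed_strictly_feasible A b c l x y s"
        using feas nonneg l_pos
        by (simp add: perturbed_strictly_feasible_def vec_less_def add_nonneg_pos)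
      have bounds: "\<xi> * \<mu> \<le> (x $ i + l $ i) * (s $ i + l $ i)"
        "(x $ i + l $ i) * (s $ i + l $ i) \<le> 1 / \<xi> * \<mu>" for i
        using shifted_product_bounds[OF nonneg PD_solution_complementary[OF sol] pos] l[of i]
        by (simp_all add: L_def U_def)
      have "(((diag x + diag l) ** (diag s + diag l)) *v 1) $ i
          = (x $ i + l $ i) * (s $ i + l $ i)" for i
        by (simp add: diag_add diag_mult_vec_nth flip: matrix_vector_mul_assoc)
      with strict bounds show ?thesis
        by (simp add: less_eq_vec_def)
    qed
    show "0 \<prec>\<^sub>v L x s \<mu> \<xi> \<and> 0 \<prec>\<^sub>v U x s \<mu> \<xi> \<and> L x s \<mu> \<xi> \<prec>\<^sub>v U x s \<mu> \<xi> \<and>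
        (\<forall>l. L x s \<mu> \<xi> \<le> l \<and> l \<le> U x s \<mu> \<xi> \<longrightarrow>
           perturbed_strictly_feasible A b c l x y s \<and>
           (\<xi> * \<mu>) *\<^sub>R 1 \<le> ((diag x + diag l) ** (diag s + diag l)) *v 1 \<and>
           ((diag x + diag l) ** (diag s + diag l)) *v 1 \<le> ((1 / \<xi>) * \<mu>) *\<^sub>R 1)"
      using L_pos L_less_U less_trans[OF L_pos L_less_U] within by (auto simp: vec_less_def)
  qed
qed

end
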